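(* Let $-\pi/2<\alpha<\pi/2$ and let $f\in\mathcal{A}$ be locally univalent (so that $f'(z)\neq 0$ for all $z\in\mathbb{D}$). The following are equivalent: (i) $f\in\mathcal{S}_\alpha$; (ii) for all $z\in\mathbb{D}$, $$\mathrm{Re}\left(1+e^{i\alpha}\frac{zf''(z)}{f'(z)}\right)\geq 1-\cos\alpha+\left(\frac{1-|z|^2}{4\cos\alpha}\right)\left|\frac{f''(z)}{f'(z)}\right|^2;$$ strict inequality holds for all $z\in\mathbb{D}$ unless $$f'(z)=\frac{1}{(1-z\zeta)^{2e^{-i\alpha}\cos\alpha}}$$ for some $\zeta\in\mathbb{T}$; (iii) for all $z\in\mathbb{D}$, $$\left|(1-|z|^2)\left(\frac{f''(z)}{f'(z)}\right)-(2\cos\alpha)\bar z\right|\leq 2\cos\alpha .$$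
   Context: $\mathbb{D}=\{z\in\mathbb{C}:|z|<1\}$ and $\mathbb{T}=\partial\mathbb{D}$. $\mathcal{A}$ is the class of analytic functions $f$ on $\mathbb{D}$ with $f(0)=0$ and $f'(0)=1$. For $-\pi/2<\alpha<\pi/2$, the (Robertson) class $\mathcal{S}_\alpha$ consists of those $f\in\mathcal{A}$ (with $f'$ non-vanishing on $\mathbb{D}$) satisfying $\mathrm{Re}\left\{e^{i\alpha}\left(1+zf''(z)/f'(z)\right)\right\}>0$ for all $z\in\mathbb{D}$. The complex power is the branch equal to $1$ at $z=0$.
   Formalization: Condition (iii) is corrected by inserting the factor e^{iα} before f''(z)/f'(z); as printed, the equivalence fails for α≠0 (e.g. α=π/3, f'(z)=(1-z)^{-e^{-iπ/3}}, z=1/2), and for α=0 the two forms agree. *)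

theory Defs
  imports "HOL-Complex_Analysis.Complex_Analysis"
begin

(* Functions on the unit disc are represented by total functions; only their values on
   ball 0 1 matter, since deriv at a point of the (open) disc depends on nothing else. *)

definition class_A :: "(complex \<Rightarrow> complex) set" where
  "class_A = {f. f holomorphic_on ball 0 1 \<and> f 0 = 0 \<and> deriv f 0 = 1}"

definition locally_univalent_on :: "(complex \<Rightarrow> complex) \<Rightarrow> complex set \<Rightarrow> bool" where
  "locally_univalent_on f S \<longleftrightarrow>
     f holomorphic_on S \<and> (\<forall>z\<in>S. \<exists>U. open U \<and> z \<in> U \<and> U \<subseteq> S \<and> inj_on f U)"

definition Robertson_class :: "real \<Rightarrow> (complex \<Rightarrow> complex) set" where
  "Robertson_class \<alpha> = {f \<in> class_A.
     (\<forall>z\<in>ball 0 1. deriv f z \<noteq> 0) \<and>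
     (\<forall>z\<in>ball 0 1. Re (exp (\<i> * of_real \<alpha>) * (1 + z * deriv (deriv f) z / deriv f z)) > 0)}"

(* For z in the disc and norm \<zeta> = 1, Re (1 - z * \<zeta>) > 0, so the principal power powr is
   continuous in z there and is the branch with value 1 at z = 0. *)
definition extremal_derivative :: "real \<Rightarrow> complex \<Rightarrow> complex \<Rightarrow> complex" where
  "extremal_derivative \<alpha> \<zeta> z =
     1 / (1 - z * \<zeta>) powr (2 * exp (- \<i> * of_real \<alpha>) * of_real (cos \<alpha>))"

end

theory Submission
  imports Defs
begin

text \<open>Put \<open>c = cos \<alpha>\<close> and \<open>q = exp (\<i> \<alpha>) f'' / f'\<close>. Both (ii) and (iii) are, pointwise, rewritings of
  \<open>|q z| \<le> |2 c + z q z|\<close>. Membership in the Robertson class says \<open>Re (c + z q z) > 0\<close>, so the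
  Cayley transform \<open>w z = z q z / (2 c + z q z)\<close> maps the disc to itself and fixes \<open>0\<close>; the
  inequality is Schwarz's lemma for \<open>w\<close>, and equality at a point makes \<open>w\<close> a rotation.\<close>

section \<open>Pointwise algebra\<close>

text \<open>The difference of the squared norms is 4c times the difference of the two sides on the
  right, and c > 0. No bound on z enters.\<close>

lemma norm_le_norm_add_iff:
  fixes c :: real and q z :: complex
  assumes "c > 0"
  shows "norm q \<le> norm (of_real (2 * c) + z * q) \<longleftrightarrow>
           (1 - (norm z)\<^sup>2) / (4 * c) * (norm q)\<^sup>2 \<le> c + Re (z * q)"
    and "norm q = norm (of_real (2 * c) + z * q) \<longleftrightarrow>
           (1 - (norm z)\<^sup>2) / (4 * c) * (norm q)\<^sup>2 = c + Re (z * q)"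
proof -
  \<comment> \<open>The denominator is cleared with real variables in place of norms and real parts,
    which keeps those terms intact when the identity is applied.\<close>
  have scale: "4 * c * (c + t - r / (4 * c) * s) = 4 * c\<^sup>2 + 4 * c * t - r * s" for r s t :: real
    using assms by (simp add: field_simps power2_eq_square)
  have expand: "(norm (of_real (2 * c) + z * q))\<^sup>2 = 4 * c\<^sup>2 + 4 * c * Re (z * q) + (norm (z * q))\<^sup>2"
    by (simp only: cmod_power2) (simp add: power2_eq_square algebra_simps)
  have eq: "(norm (of_real (2 * c) + z * q))\<^sup>2 - (norm q)\<^sup>2 =
      4 * c * (c + Re (z * q) - (1 - (norm z)\<^sup>2) / (4 * c) * (norm q)\<^sup>2)"
    unfolding expand scale by (simp add: norm_mult power_mult_distrib algebra_simps)
  show "norm q \<le> norm (of_real (2 * c) + z * q) \<longleftrightarrow>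
           (1 - (norm z)\<^sup>2) / (4 * c) * (norm q)\<^sup>2 \<le> c + Re (z * q)"
  proof -
    have "norm q \<le> norm (of_real (2 * c) + z * q) \<longleftrightarrow>
        (norm (of_real (2 * c) + z * q))\<^sup>2 - (norm q)\<^sup>2 \<ge> 0"
      by (simp add: power_mono_iff)
    then show ?thesis
      unfolding eq using assms by (simp add: zero_le_mult_iff)
  qed
  show "norm q = norm (of_real (2 * c) + z * q) \<longleftrightarrow>
           (1 - (norm z)\<^sup>2) / (4 * c) * (norm q)\<^sup>2 = c + Re (z * q)"
  proof -
    have "norm q = norm (of_real (2 * c) + z * q) \<longleftrightarrow>
        (norm (of_real (2 * c) + z * q))\<^sup>2 - (norm q)\<^sup>2 = 0"
      by (auto simp: power2_eq_iff_nonneg)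
    then show ?thesis
      unfolding eq using assms by auto
  qed
qed

text \<open>Completing the square: for |z| < 1 both conditions say that q lies in the closed disc
  with centre 2c \<open>cnj z\<close> / (1 - |z|^2) and radius 2c / (1 - |z|^2).\<close>

lemma norm_diff_cnj_le_iff:
  fixes c :: real and q z :: complex
  assumes "c > 0" and "norm z < 1"
  shows "norm (of_real (1 - (norm z)\<^sup>2) * q - of_real (2 * c) * cnj z) \<le> 2 * c \<longleftrightarrow>
           (1 - (norm z)\<^sup>2) / (4 * c) * (norm q)\<^sup>2 \<le> c + Re (z * q)"
proof -
  let ?r = "1 - (norm z)\<^sup>2"
  have r: "?r > 0"
    using assms(2) by (simp add: power_less_one_iff)
  have scale: "4 * c * (c + t - r / (4 * c) * s) = 4 * c\<^sup>2 + 4 * c * t - r * s" for r s t :: real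
    using assms(1) by (simp add: field_simps power2_eq_square)
  have expand: "(norm (of_real ?r * q - of_real (2 * c) * cnj z))\<^sup>2 =
      ?r\<^sup>2 * (norm q)\<^sup>2 - 4 * c * ?r * Re (z * q) + 4 * c\<^sup>2 * (norm z)\<^sup>2"
    by (simp only: cmod_power2) (simp add: power2_eq_square algebra_simps)
  \<comment> \<open>The constant terms combine to 4c^2 (1 - |z|^2), so the positive factor
    \<open>?r\<close> splits off.\<close>
  have eq: "(2 * c)\<^sup>2 - (norm (of_real ?r * q - of_real (2 * c) * cnj z))\<^sup>2 =
      ?r * (4 * c * (c + Re (z * q) - ?r / (4 * c) * (norm q)\<^sup>2))"
    unfolding expand scale by (simp add: power2_eq_square algebra_simps)
  have "norm (of_real ?r * q - of_real (2 * c) * cnj z) \<le> 2 * c \<longleftrightarrow>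
      (2 * c)\<^sup>2 - (norm (of_real ?r * q - of_real (2 * c) * cnj z))\<^sup>2 \<ge> 0"
    unfolding diff_ge_0_iff_ge using assms(1) by (subst power_mono_iff) auto
  then show ?thesis
    unfolding eq using assms(1) r by (simp add: zero_le_mult_iff)
qed

section \<open>Schwarz's lemma for the Cayley transform\<close>

text \<open>With p = c + z q, the map w = (p - c) / (p + c) sends the disc into itself and 0 to 0.
  Dividing |w| \<le> |z| by |z| gives the bound. Equality makes w(u) = \<zeta> u, so q = \<zeta> (2c
  + u q), which is solved for q.\<close>

lemma
  fixes c :: real and q :: "complex \<Rightarrow> complex"
  assumes "c > 0" and holq: "q holomorphic_on ball 0 1"
    and Re_pos: "\<And>z. norm z < 1 \<Longrightarrow> Re (of_real c + z * q z) > 0"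
  shows Re_pos_imp_norm_le: "norm z < 1 \<Longrightarrow> norm (q z) \<le> norm (of_real (2 * c) + z * q z)"
    and Re_pos_norm_eq_imp: "norm z < 1 \<Longrightarrow> norm (q z) = norm (of_real (2 * c) + z * q z) \<Longrightarrow>
      \<exists>\<zeta>. norm \<zeta> = 1 \<and> (\<forall>u\<in>ball 0 1. q u * (1 - u * \<zeta>) = of_real (2 * c) * \<zeta>)"
proof -
  define d where "d z = of_real (2 * c) + z * q z" for z
  define w where "w z = z * q z / d z" for z
  have Re_d: "Re (d z) > c" if "norm z < 1" for z
    using Re_pos[OF that] by (simp add: d_def)
  have d0: "d z \<noteq> 0" if "norm z < 1" for z
    using Re_d[OF that] \<open>c > 0\<close> by auto
  have hold: "d holomorphic_on ball 0 1"
    unfolding d_def by (intro holomorphic_intros holq)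
  have holw: "w holomorphic_on ball 0 1"
    unfolding w_def by (intro holomorphic_intros holq hold) (simp add: d0)
  have w_less: "norm (w z) < 1" if "norm z < 1" for z
  proof -
    \<comment> \<open>This is |p + c|^2 - |p - c|^2 = 4c Re p for p = c + z q.\<close>
    have "(norm (d z))\<^sup>2 - (norm (z * q z))\<^sup>2 = 4 * c * (c + Re (z * q z))"
      unfolding d_def by (simp only: cmod_power2) (simp add: power2_eq_square algebra_simps)
    also have "\<dots> > 0"
      using Re_pos[OF that] \<open>c > 0\<close> by simp
    finally have "norm (z * q z) < norm (d z)"
      by (simp add: power2_less_imp_less)
    then show ?thesis
      using d0[OF that] by (simp add: w_def norm_divide)
  qed
  have w0: "w 0 = 0"
    by (simp add: w_def)
  have w_le: "norm (w z) \<le> norm z" if "norm z < 1" for z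
    using Schwarz_Lemma(1)[OF holw w0 _ that] w_less by blast
  have dw_le: "norm (deriv w 0) \<le> 1"
    using Schwarz_Lemma(2)[OF holw w0, of 0] w_less by simp
  \<comment> \<open>In the product rule at 0 the derivative of \<open>q z / d z\<close> is
    multiplied by 0, so only its value at 0 survives.\<close>
  have "((\<lambda>z. z * (q z / d z)) has_field_derivative 1 * (q 0 / d 0) + deriv (\<lambda>z. q z / d z) 0 * 0) (at 0)"
    by (rule DERIV_mult[OF DERIV_ident], rule holomorphic_derivI[where S = "ball 0 1"])
       (auto intro!: holomorphic_intros holq hold simp: d0)
  then have dw0: "deriv w 0 = q 0 / d 0"
    by (intro DERIV_imp_deriv) (simp add: w_def [abs_def])
  show "norm (q z) \<le> norm (of_real (2 * c) + z * q z)" if z: "norm z < 1" for z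
  \<comment> \<open>The factor z cannot be cancelled at the origin; there the bound on
    \<open>deriv w 0\<close> takes over.\<close>
  proof (cases "z = 0")
    case True
    then have "norm (q z / d z) \<le> 1"
      using dw_le dw0 by simp
    then show ?thesis
      using d0[OF z] by (simp add: norm_divide d_def field_simps)
  next
    case False
    have "norm (z * (q z / d z)) \<le> norm z"
      using w_le[OF z] by (simp add: w_def)
    then have "norm (q z / d z) \<le> 1"
      using False unfolding norm_mult by simp
    then show ?thesis
      using d0[OF z] by (simp add: norm_divide d_def field_simps)
  qed
  show "\<exists>\<zeta>. norm \<zeta> = 1 \<and> (\<forall>u\<in>ball 0 1. q u * (1 - u * \<zeta>) = of_real (2 * c) * \<zeta>)"
    if z: "norm z < 1" and eq: "norm (q z) = norm (of_real (2 * c) + z * q z)" for z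
  proof -
    have n1: "norm (q z / d z) = 1"
      using eq d0[OF z] by (simp add: norm_divide d_def)
    \<comment> \<open>Equality at the origin or away from it yields one of the two equality cases of
      Schwarz's lemma.\<close>
    have "(\<exists>z. norm z < 1 \<and> z \<noteq> 0 \<and> norm (w z) = norm z) \<or> norm (deriv w 0) = 1"
    proof (cases "z = 0")
      case True
      then show ?thesis using n1 dw0 by simp
    next
      case False
      have "norm (w z) = norm (z * (q z / d z))"
        by (simp add: w_def)
      then have "norm (w z) = norm z"
        unfolding norm_mult n1 by simp
      then show ?thesis using z False by blast
    qed
    then obtain \<zeta> where \<zeta>: "\<And>u. norm u < 1 \<Longrightarrow> w u = \<zeta> * u" "norm \<zeta> = 1"
      using Schwarz_Lemma(3)[OF holw w0, of 0] w_less by auto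
    \<comment> \<open>At u = 0 the identity w(u) = \<zeta> u carries no information on q, so the
      value of q / d there is read off from the derivative.\<close>
    have "deriv w 0 = deriv (\<lambda>u. \<zeta> * u) 0"
      by (rule deriv_cong_ev)
         (use \<zeta>(1) in \<open>auto simp: eventually_at_topological eventually_nhds intro!: exI[of _ "ball 0 1"]\<close>)
    then have "q 0 / d 0 = \<zeta>"
      using dw0 by simp
    then have q_div_d: "q u / d u = \<zeta>" if "norm u < 1" for u
    proof (cases "u = 0")
      case False
      have "u * (q u / d u) = u * \<zeta>"
        using \<zeta>(1)[OF that] by (simp add: w_def mult.commute)
      then show ?thesis
        using False unfolding mult_cancel_left by blast
    qed (use \<open>q 0 / d 0 = \<zeta>\<close> in simp)
    have "q u * (1 - u * \<zeta>) = of_real (2 * c) * \<zeta>" if "norm u < 1" for u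
    proof -
      have "q u = \<zeta> * d u"
        using q_div_d[OF that] d0[OF that] by (simp add: field_simps)
      then show ?thesis
        by (simp add: d_def algebra_simps)
    qed
    then show ?thesis
      using \<zeta>(2) by auto
  qed
qed

section \<open>Integrating the extremal equation\<close>

text \<open>Keeps the base off the branch cut of the principal power, so that the power is
  holomorphic in z.\<close>

lemma one_minus_mult_notin_nonpos_Reals:
  fixes z \<zeta> :: complex
  assumes "norm z < 1" and "norm \<zeta> = 1"
  shows "1 - z * \<zeta> \<notin> \<real>\<^sub>\<le>\<^sub>0"
proof
  assume "1 - z * \<zeta> \<in> \<real>\<^sub>\<le>\<^sub>0"
  then have "Re (z * \<zeta>) \<ge> 1"
    by (auto simp: complex_nonpos_Reals_iff)
  moreover have "norm (z * \<zeta>) < 1"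
    using assms by (simp add: norm_mult)
  ultimately show False
    using complex_Re_le_cmod[of "z * \<zeta>"] by linarith
qed

text \<open>Integrating factor: the product of g with \<open>(1 - z * \<zeta>) powr a\<close> has
  derivative zero by the differential equation, and its value at 0 is 1.\<close>

lemma log_deriv_imp_eq_powr:
  fixes a \<zeta> :: complex and g :: "complex \<Rightarrow> complex"
  assumes holg: "g holomorphic_on ball 0 1" and "g 0 = 1" and \<zeta>: "norm \<zeta> = 1"
    and ode: "\<And>z. norm z < 1 \<Longrightarrow> deriv g z * (1 - z * \<zeta>) = a * \<zeta> * g z"
    and "norm z < 1"
  shows "g z = 1 / (1 - z * \<zeta>) powr a"
proof -
  define h where "h z = g z * (1 - z * \<zeta>) powr a" for z
  have "(h has_field_derivative 0) (at u within ball 0 1)" if "u \<in> ball 0 1" for u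
  proof -
    have u: "norm u < 1"
      using that by simp
    have ne: "1 - u * \<zeta> \<notin> \<real>\<^sub>\<le>\<^sub>0"
      by (rule one_minus_mult_notin_nonpos_Reals[OF u \<zeta>])
    then have nz: "1 - u * \<zeta> \<noteq> 0"
      by auto
    have g': "(g has_field_derivative deriv g u) (at u)"
      using holomorphic_derivI[OF holg _ that] by simp
    have "((\<lambda>z. (1 - z * \<zeta>) powr a) has_field_derivative
        (a * (1 - u * \<zeta>) powr (a - 1)) * (- \<zeta>)) (at u)"
      using ne by (auto intro!: derivative_eq_intros)
    from DERIV_mult[OF g' this]
    have "(h has_field_derivative
       deriv g u * (1 - u * \<zeta>) powr a + (a * (1 - u * \<zeta>) powr (a - 1)) * (- \<zeta>) * g u) (at u)"
      by (simp add: h_def [abs_def])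
    \<comment> \<open>Lowering the exponent exposes a common factor whose cofactor is the difference
      of the two sides of \<open>ode\<close>.\<close>
    moreover have "(1 - u * \<zeta>) powr a = (1 - u * \<zeta>) powr (a - 1) * (1 - u * \<zeta>)"
      using nz by (simp add: powr_diff)
    then have "deriv g u * (1 - u * \<zeta>) powr a + (a * (1 - u * \<zeta>) powr (a - 1)) * (- \<zeta>) * g u =
        (1 - u * \<zeta>) powr (a - 1) * (deriv g u * (1 - u * \<zeta>) - a * \<zeta> * g u)"
      by (simp only:) (simp add: algebra_simps)
    ultimately show ?thesis
      using ode[OF u] has_field_derivative_at_within by fastforce
  qed
  then obtain k where k: "\<And>u. u \<in> ball 0 1 \<Longrightarrow> h u = k"
    using has_field_derivative_zero_constant[of "ball 0 1" h] by auto
  have "h z = h 0"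
    using k[of z] k[of 0] assms(5) by simp
  also have "\<dots> = 1"
    using \<open>g 0 = 1\<close> by (simp add: h_def)
  finally have "g z * (1 - z * \<zeta>) powr a = 1"
    by (simp add: h_def)
  moreover from this have "(1 - z * \<zeta>) powr a \<noteq> 0"
    by (metis mult_zero_right zero_neq_one)
  ultimately show ?thesis
    by (metis nonzero_eq_divide_eq)
qed

section \<open>Application to the Robertson class\<close>

lemma locally_univalent_on_imp_deriv_nonzero:
  assumes "locally_univalent_on f S" and "z \<in> S"
  shows "deriv f z \<noteq> 0"
proof -
  obtain U where "open U" "z \<in> U" "U \<subseteq> S" "inj_on f U"
    using assms by (auto simp: locally_univalent_on_def)
  moreover have "f holomorphic_on U"
    using assms \<open>U \<subseteq> S\<close> by (auto simp: locally_univalent_on_def intro: holomorphic_on_subset)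
  ultimately show ?thesis
    using holomorphic_injective_imp_regular by blast
qed

text \<open>The factor \<open>exp (\<i> * of_real \<alpha>)\<close> in the third condition matters
  for \<alpha> \<noteq> 0: without it, for the extremal derivative with \<zeta> = 1 and z = r
  tending to 1, the norm would tend to 2 cos \<alpha> |2 exp(-i \<alpha>) - 1| > 2 cos
  \<alpha>.\<close>

theorem theorem2p1:
  fixes \<alpha> :: real and f :: "complex \<Rightarrow> complex"
  assumes "- pi / 2 < \<alpha>" and "\<alpha> < pi / 2"
    and "f \<in> class_A"
    and "locally_univalent_on f (ball 0 1)"
  defines "ii_lhs \<equiv> \<lambda>z. Re (1 + exp (\<i> * of_real \<alpha>) * (z * deriv (deriv f) z / deriv f z))"
    and "ii_rhs \<equiv> \<lambda>z. 1 - cos \<alpha>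
           + ((1 - (norm z)\<^sup>2) / (4 * cos \<alpha>)) * (norm (deriv (deriv f) z / deriv f z))\<^sup>2"
  shows "(f \<in> Robertson_class \<alpha> \<longleftrightarrow> (\<forall>z\<in>ball 0 1. ii_lhs z \<ge> ii_rhs z))
    \<and> ((\<forall>z\<in>ball 0 1. ii_lhs z \<ge> ii_rhs z) \<longleftrightarrow>
        (\<forall>z\<in>ball 0 1.
           norm (of_real (1 - (norm z)\<^sup>2) * (exp (\<i> * of_real \<alpha>) * (deriv (deriv f) z / deriv f z))
                 - of_real (2 * cos \<alpha>) * cnj z) \<le> 2 * cos \<alpha>))
    \<and> ((\<forall>z\<in>ball 0 1. ii_lhs z \<ge> ii_rhs z) \<longrightarrow>
        \<not> (\<exists>\<zeta>. norm \<zeta> = 1 \<and> (\<forall>z\<in>ball 0 1. deriv f z = extremal_derivative \<alpha> \<zeta> z)) \<longrightarrow>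
        (\<forall>z\<in>ball 0 1. ii_lhs z > ii_rhs z))"
proof -
  define c where "c = cos \<alpha>"
  \<comment> \<open>The absorbed factor has modulus 1, so |q| = |f''/f'| and all three conditions
    depend on \<alpha> only through c and q.\<close>
  define q where "q z = exp (\<i> * of_real \<alpha>) * (deriv (deriv f) z / deriv f z)" for z
  have c: "c > 0"
    unfolding c_def using assms(1,2) by (intro cos_gt_zero_pi) auto
  have holf: "f holomorphic_on ball 0 1"
    using assms(3) by (simp add: class_A_def)
  have f'0: "deriv f z \<noteq> 0" if "z \<in> ball 0 1" for z
    using locally_univalent_on_imp_deriv_nonzero[OF assms(4) that] .
  have holf': "deriv f holomorphic_on ball 0 1"
    by (intro holomorphic_deriv holf) auto
  have holq: "q holomorphic_on ball 0 1"
    unfolding q_def by (intro holomorphic_intros holf' f'0) auto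
  have norm_q: "norm (q z) = norm (deriv (deriv f) z / deriv f z)" for z
    by (simp add: q_def norm_mult norm_divide)
  have lhs: "ii_lhs z = 1 + Re (z * q z)" for z
    by (simp add: ii_lhs_def q_def mult_ac)
  have rhs: "ii_rhs z = 1 - c + (1 - (norm z)\<^sup>2) / (4 * c) * (norm (q z))\<^sup>2" for z
    by (simp add: ii_rhs_def c_def norm_q)
  have le_iff: "ii_rhs z \<le> ii_lhs z \<longleftrightarrow>
      (1 - (norm z)\<^sup>2) / (4 * c) * (norm (q z))\<^sup>2 \<le> c + Re (z * q z)" for z
    unfolding lhs rhs by linarith
  \<comment> \<open>The constant term \<open>exp (\<i> * of_real \<alpha>)\<close> has real part
    c.\<close>
  have "Re (exp (\<i> * of_real \<alpha>) * (1 + z * deriv (deriv f) z / deriv f z)) =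
      Re (of_real c + z * q z)" for z
  proof -
    have "exp (\<i> * of_real \<alpha>) * (1 + z * deriv (deriv f) z / deriv f z) =
        exp (\<i> * of_real \<alpha>) + z * q z"
      by (simp add: q_def algebra_simps)
    then show ?thesis
      by (simp only: plus_complex.sel) (simp add: c_def Re_exp)
  qed
  then have Robertson: "f \<in> Robertson_class \<alpha> \<longleftrightarrow> (\<forall>z\<in>ball 0 1. Re (of_real c + z * q z) > 0)"
    using assms(3) f'0 by (simp only: Robertson_class_def mem_Collect_eq) simp
  have i_iff_ii: "f \<in> Robertson_class \<alpha> \<longleftrightarrow> (\<forall>z\<in>ball 0 1. ii_lhs z \<ge> ii_rhs z)"
  proof
    assume "f \<in> Robertson_class \<alpha>"
    then have "\<And>z. norm z < 1 \<Longrightarrow> Re (of_real c + z * q z) > 0"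
      by (simp add: Robertson)
    then show "\<forall>z\<in>ball 0 1. ii_lhs z \<ge> ii_rhs z"
      using Re_pos_imp_norm_le[OF c holq] norm_le_norm_add_iff(1)[OF c] by (auto simp: le_iff)
  next
    assume ii: "\<forall>z\<in>ball 0 1. ii_lhs z \<ge> ii_rhs z"
    have "Re (of_real c + z * q z) > 0" if z: "z \<in> ball 0 1" for z
    \<comment> \<open>The quadratic term gives strict positivity only where q is nonzero; at a zero
      of q the expression is c itself.\<close>
    proof (cases "q z = 0")
      case True
      then show ?thesis using c by simp
    next
      case False
      have "1 - (norm z)\<^sup>2 > 0"
        using z by (simp add: power_less_one_iff)
      then have "(1 - (norm z)\<^sup>2) / (4 * c) * (norm (q z))\<^sup>2 > 0"
        using False c by simp
      also have "\<dots> \<le> c + Re (z * q z)"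
        using ii z le_iff by blast
      finally show ?thesis by simp
    qed
    then show "f \<in> Robertson_class \<alpha>"
      by (simp add: Robertson)
  qed
  have "(\<forall>z\<in>ball 0 1. ii_lhs z \<ge> ii_rhs z) \<longleftrightarrow>
      (\<forall>z\<in>ball 0 1. norm (of_real (1 - (norm z)\<^sup>2) * q z - of_real (2 * c) * cnj z) \<le> 2 * c)"
    using norm_diff_cnj_le_iff[OF c] by (intro ball_cong) (simp_all add: le_iff)
  moreover have "\<forall>z\<in>ball 0 1. ii_lhs z > ii_rhs z"
    if ii: "\<forall>z\<in>ball 0 1. ii_lhs z \<ge> ii_rhs z"
      and not_extremal: "\<nexists>\<zeta>. norm \<zeta> = 1 \<and> (\<forall>z\<in>ball 0 1. deriv f z = extremal_derivative \<alpha> \<zeta> z)"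
  proof (rule ccontr)
    assume "\<not> (\<forall>z\<in>ball 0 1. ii_lhs z > ii_rhs z)"
    then obtain z where z: "norm z < 1" and "ii_lhs z = ii_rhs z"
      using ii by force
    then have "(1 - (norm z)\<^sup>2) / (4 * c) * (norm (q z))\<^sup>2 = c + Re (z * q z)"
      unfolding lhs rhs by linarith
    then have eq: "norm (q z) = norm (of_real (2 * c) + z * q z)"
      by (simp only: norm_le_norm_add_iff(2)[OF c])
    have "\<And>z. norm z < 1 \<Longrightarrow> Re (of_real c + z * q z) > 0"
      using ii i_iff_ii Robertson by simp
    from Re_pos_norm_eq_imp[OF c holq this z eq] obtain \<zeta> where \<zeta>: "norm \<zeta> = 1"
      and q_eq: "\<And>u. norm u < 1 \<Longrightarrow> q u * (1 - u * \<zeta>) = of_real (2 * c) * \<zeta>"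
      by auto
    \<comment> \<open>Undoing the rotation in q turns \<open>q_eq\<close> into a linear equation for
      f'; its coefficient 2 exp(-i \<alpha>) cos \<alpha> becomes the exponent of the extremal
      derivative.\<close>
    have ode: "deriv (deriv f) u * (1 - u * \<zeta>) =
        2 * exp (- \<i> * of_real \<alpha>) * of_real (cos \<alpha>) * \<zeta> * deriv f u" if u: "norm u < 1" for u
    proof -
      have "deriv (deriv f) u = exp (- \<i> * of_real \<alpha>) * q u * deriv f u"
        using f'0[of u] u by (simp add: q_def exp_minus)
      then have "deriv (deriv f) u * (1 - u * \<zeta>) =
          exp (- \<i> * of_real \<alpha>) * deriv f u * (q u * (1 - u * \<zeta>))"
        by (simp only: mult_ac)
      also have "\<dots> = 2 * exp (- \<i> * of_real \<alpha>) * of_real (cos \<alpha>) * \<zeta> * deriv f u"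
        unfolding q_eq[OF u] by (simp add: c_def mult_ac)
      finally show ?thesis .
    qed
    have "deriv f 0 = 1"
      using assms(3) by (simp add: class_A_def)
    from log_deriv_imp_eq_powr[OF holf' this \<zeta> ode]
    have "\<forall>u\<in>ball 0 1. deriv f u = extremal_derivative \<alpha> \<zeta> u"
      by (simp add: extremal_derivative_def)
    with not_extremal \<zeta> show False
      by blast
  qed
  ultimately show ?thesis
    using i_iff_ii unfolding q_def c_def by blast
qed

end
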